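(* Let $1<p<\infty$, let $A=\lambda I$ on $\mathbb{R}$ with $0<\lambda<1$, and let $d\mu=e^{|x|}\,dx$ on $\mathbb{R}$. Then there exists a weight $w$ such that $w\in\mathcal{A}_{A,p}(\mu)$ and $w\notin\mathcal{A}_p(\mu)$.
   Context: A weight is a locally integrable function $w$ on $\mathbb{R}$ with $0<w<\infty$ a.e.; $w_A(x)=w(Ax)$ (here $w_A(x)=w(\lambda x)$). For a measure $\mu$ on $\mathbb{R}$ and $1<p<\infty$, $w\in\mathcal{A}_{A,p}(\mu)$ if $\sup_Q \frac1{\mu(Q)}\int_Q w_A\,d\mu\left(\frac1{\mu(Q)}\int_Q w^{-\frac1{p-1}}\,d\mu\right)^{p-1}<\infty$, the supremum being over all bounded intervals $Q\subset\mathbb{R}$ (the one-dimensional cubes); $\mathcal{A}_p(\mu)$ is the class obtained with $A=I$. *)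

theory Defs
  imports "HOL-Analysis.Analysis"
begin

text \<open>
  Weights are real-valued functions, so the condition \<open>w < \<infinity>\<close> a.e. is built in
  (a weight may be changed on a null set). Local integrability implies Lebesgue measurability.
\<close>

definition weight :: "(real \<Rightarrow> real) \<Rightarrow> bool" where
  "weight w \<longleftrightarrow>
     (\<forall>K. compact K \<longrightarrow> set_integrable lebesgue K w) \<and> (AE x in lebesgue. 0 < w x)"

text \<open>
  Nondegenerate bounded intervals, with or without their endpoints.
\<close>

definition bounded_intervals :: "real set set" where
  "bounded_intervals = {Q. is_interval Q \<and> bounded Q \<and> interior Q \<noteq> {}}"

text \<open>
  Power with a positive exponent on \<open>[0, \<infinity>]\<close>, where \<open>\<infinity>\<close> raised to \<open>r\<close> is \<open>\<infinity>\<close>; only meant for \<open>r > 0\<close>.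
\<close>

definition ennreal_powr :: "ennreal \<Rightarrow> real \<Rightarrow> ennreal" where
  "ennreal_powr x r = (if x = \<infinity> then \<infinity> else ennreal (enn2real x powr r))"

definition average :: "real measure \<Rightarrow> real set \<Rightarrow> (real \<Rightarrow> real) \<Rightarrow> ennreal" where
  "average \<mu> Q f = (\<integral>\<^sup>+x\<in>Q. ennreal (f x) \<partial>\<mu>) / emeasure \<mu> Q"

text \<open>
  The averages are Lebesgue integrals with values in \<open>[0, \<infinity>]\<close>: a function for which one of
  them diverges on some interval is not in the class (for a weight, neither factor vanishes
  when \<open>\<mu>\<close> has a positive density).
\<close>

definition A_class :: "(real \<Rightarrow> real) \<Rightarrow> real \<Rightarrow> real measure \<Rightarrow> (real \<Rightarrow> real) set" where
  "A_class A p \<mu> =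
     {w. (SUP Q\<in>bounded_intervals.
            average \<mu> Q (\<lambda>x. w (A x)) *
            ennreal_powr (average \<mu> Q (\<lambda>x. w x powr (- 1 / (p - 1)))) (p - 1)) < \<infinity>}"

definition Ap_class :: "real \<Rightarrow> real measure \<Rightarrow> (real \<Rightarrow> real) set" where
  "Ap_class p \<mu> = A_class (\<lambda>x. x) p \<mu>"

definition exp_measure :: "real measure" where
  "exp_measure = density lebesgue (\<lambda>x. ennreal (exp \<bar>x\<bar>))"

end

theory Submission
  imports Defs
begin

text \<open>
  Take \<open>w x = exp ((p - 1) * \<bar>x\<bar>)\<close>. Its dual weight is \<open>exp (- \<bar>x\<bar>)\<close>, which cancels the
  density of \<open>\<mu>\<close>, so the dual average over \<open>Q\<close> is \<open>\<bar>Q\<bar> / \<mu> Q\<close>. If \<open>M\<close> is the supremum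
  of \<open>\<bar>x\<bar>\<close> on \<open>Q\<close>, then \<open>w (l * x) \<le> exp ((p - 1) * l * M)\<close> on \<open>Q\<close>, while the part of
  \<open>Q\<close> where \<open>\<bar>x\<bar> \<ge> l * M\<close> has length at least \<open>(1 - l) * \<bar>Q\<bar> / 2\<close>, whence
  \<open>\<bar>Q\<bar> / \<mu> Q \<le> 2 / (1 - l) * exp (- l * M)\<close> and the product of the averages is bounded.
  Without the dilation, the product over \<open>[0, R]\<close> grows at least like \<open>R powr (p - 1)\<close>.
\<close>

section \<open>Endpoints and measurability of bounded intervals\<close>

lemma bounded_intervals_sandwich:
  assumes "Q \<in> bounded_intervals"
  obtains a b :: real where "a < b" "{a<..<b} \<subseteq> Q" "Q \<subseteq> {a..b}"
proof -
  have Q: "is_interval Q" "bounded Q" "interior Q \<noteq> {}"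
    using assms by (auto simp: bounded_intervals_def)
  then have bdd: "bdd_below Q" "bdd_above Q" and ne: "Q \<noteq> {}"
    using bounded_imp_bdd_below bounded_imp_bdd_above interior_subset[of Q] by auto
  have sub: "Q \<subseteq> {Inf Q..Sup Q}"
    using bdd by (auto intro: cInf_lower cSup_upper)
  have "Inf Q < Sup Q"
  proof (rule ccontr)
    \<comment> \<open>Equal endpoints would squeeze \<open>Q\<close> into a single point, whose
      interior is empty; this is where nondegeneracy enters.\<close>
    assume "\<not> Inf Q < Sup Q"
    then have "Q \<subseteq> {Inf Q}" using sub by force
    then have "interior Q \<subseteq> interior {Inf Q}" by (rule interior_mono)
    with Q(3) show False by simp
  qed
  moreover have "{Inf Q<..<Sup Q} \<subseteq> Q"
  proof
    fix x assume "x \<in> {Inf Q<..<Sup Q}"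
    then obtain y z where "y \<in> Q" "y < x" "z \<in> Q" "x < z"
      using ne bdd by (auto simp: cInf_less_iff less_cSup_iff)
    then show "x \<in> Q"
      using Q(1) unfolding is_interval_1 by (meson less_imp_le)
  qed
  ultimately show thesis using sub that by blast
qed

lemma bounded_intervals_sets_lebesgue:
  assumes "Q \<in> bounded_intervals"
  shows "Q \<in> sets lebesgue"
  using assms measurable_convex[of Q]
  by (auto simp: bounded_intervals_def is_interval_convex fmeasurable_def)

section \<open>Estimates for \<open>exp_measure\<close> and for averages\<close>

lemma sets_exp_measure [simp]: "sets exp_measure = sets lebesgue"
  by (simp add: exp_measure_def)

lemma borel_imp_lebesgue_measurable:
  "f \<in> borel_measurable borel \<Longrightarrow> f \<in> borel_measurable lebesgue"
  by (rule measurable_completion) simp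

lemma nn_integral_exp_measure:
  assumes "f \<in> borel_measurable borel" "Q \<in> sets lebesgue"
  shows "(\<integral>\<^sup>+x\<in>Q. f x \<partial>exp_measure) = (\<integral>\<^sup>+x\<in>Q. (ennreal (exp \<bar>x\<bar>) * f x) \<partial>lebesgue)"
proof -
  have "(\<lambda>x. ennreal (exp \<bar>x\<bar>)) \<in> borel_measurable lebesgue" "f \<in> borel_measurable lebesgue"
    using assms(1) by (intro borel_imp_lebesgue_measurable; measurable)+
  with assms(2) show ?thesis
    unfolding exp_measure_def
    by (subst nn_integral_density)
       (auto intro!: borel_measurable_times_ennreal borel_measurable_indicator simp: mult.assoc)
qed

lemma emeasure_exp_measure:
  assumes "Q \<in> sets lebesgue"
  shows "emeasure exp_measure Q = (\<integral>\<^sup>+x\<in>Q. ennreal (exp \<bar>x\<bar>) \<partial>lebesgue)"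
  unfolding exp_measure_def
  by (rule emeasure_density) (auto intro!: borel_imp_lebesgue_measurable assms)

lemma interval_le_nn_set_integral:
  assumes "c \<le> d" "{c<..<d} \<subseteq> Q" "\<And>x. x \<in> {c<..<d} \<Longrightarrow> k \<le> f x" "0 \<le> k"
  shows "ennreal (k * (d - c)) \<le> (\<integral>\<^sup>+x\<in>Q. ennreal (f x) \<partial>lebesgue)"
proof -
  have "ennreal (k * (d - c)) = (\<integral>\<^sup>+x. ennreal k * indicator {c<..<d} x \<partial>lebesgue)"
    using assms(1,4) by (simp add: nn_integral_cmult_indicator ennreal_mult')
  also have "\<dots> \<le> (\<integral>\<^sup>+x\<in>Q. ennreal (f x) \<partial>lebesgue)"
    using assms(2,3) by (intro nn_integral_mono) (auto simp: indicator_def intro!: ennreal_leI)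
  finally show ?thesis .
qed

lemma ennreal_powr_mono:
  assumes "x \<le> y" "0 \<le> r"
  shows "ennreal_powr x r \<le> ennreal_powr y r"
\<comment> \<open>\<open>enn2real\<close> sends infinity to 0, so monotonicity of the real power can
  be used only at finite values.\<close>
proof (cases "y = \<infinity>")
  case False
  then have "x \<noteq> \<infinity>" using assms(1) by (auto simp: top_unique)
  with False show ?thesis
    unfolding ennreal_powr_def using assms
    by (auto intro!: ennreal_leI powr_mono2 enn2real_mono simp: top.not_eq_extremum)
qed (simp add: ennreal_powr_def)

lemma ennreal_powr_ennreal: "0 \<le> x \<Longrightarrow> ennreal_powr (ennreal x) r = ennreal (x powr r)"
  by (simp add: ennreal_powr_def)

text \<open>A crude bound, which serves to show that \<open>Q\<close> has finite measure.\<close>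

lemma emeasure_exp_measure_le:
  assumes "Q \<in> sets lebesgue" "Q \<subseteq> {a..b}" "a \<le> b"
  shows "emeasure exp_measure Q \<le> ennreal (exp (max \<bar>a\<bar> \<bar>b\<bar>) * (b - a))"
proof -
  have "emeasure exp_measure Q \<le>
    (\<integral>\<^sup>+x. ennreal (exp (max \<bar>a\<bar> \<bar>b\<bar>)) * indicator {a..b} x \<partial>lebesgue)"
    unfolding emeasure_exp_measure[OF assms(1)] using assms(2)
    by (intro nn_integral_mono) (auto simp: indicator_def intro!: ennreal_leI)
  also have "\<dots> = ennreal (exp (max \<bar>a\<bar> \<bar>b\<bar>) * (b - a))"
    using assms(3) by (simp add: nn_integral_cmult_indicator ennreal_mult')
  finally show ?thesis .
qed

lemma emeasure_exp_measure_ge: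
  assumes Q: "Q \<in> sets lebesgue" "{a<..<b} \<subseteq> Q" "a < b" and l: "0 < l" "l < 1"
  shows "ennreal (exp (l * max \<bar>a\<bar> \<bar>b\<bar>) * ((1 - l) * (b - a) / 2)) \<le> emeasure exp_measure Q"
proof -
  define M where "M = max \<bar>a\<bar> \<bar>b\<bar>"
  define s where "s = (1 - l) * ((b - a) / 2)"
  have s0: "0 \<le> s" using Q(3) l by (simp add: s_def)
  \<comment> \<open>The triangle inequality gives \<open>b - a \<le> 2 * M\<close>. Hence moving
    inward by at most \<open>s\<close> from an endpoint of modulus \<open>M\<close> keeps the
    modulus at least \<open>M - s\<close>, which is at least \<open>l * M\<close>.\<close>
  have sM: "s \<le> (1 - l) * M"
    unfolding s_def using l by (intro mult_left_mono) (auto simp: M_def)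
  then have sM': "l * M \<le> M - s" by (simp add: algebra_simps)
  have "s \<le> 1 * ((b - a) / 2)"
    unfolding s_def using Q(3) l by (intro mult_right_mono) auto
  then have "s \<le> b - a" using Q(3) by simp
  then have sub: "{b - s<..<b} \<subseteq> Q" "{a<..<a + s} \<subseteq> Q"
    using Q(2) by (auto simp: subset_eq)
  have "ennreal (exp (l * M) * s) \<le> (\<integral>\<^sup>+x\<in>Q. ennreal (exp \<bar>x\<bar>) \<partial>lebesgue)"
  proof (cases "M = b")
    case True
    then show ?thesis
      using interval_le_nn_set_integral[of "b - s" b Q "exp (l * M)" "\<lambda>x. exp \<bar>x\<bar>"] s0 sM' sub
      by (simp add: abs_if)
  next
    case False
    \<comment> \<open>Since \<open>a < b\<close>, neither \<open>a\<close> nor \<open>- b\<close>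
      can be the maximum: the first is less than \<open>b\<close>, the second less than
      \<open>- a\<close>.\<close>
    then have "M = - a" using Q(3) by (auto simp: M_def)
    then show ?thesis
      using interval_le_nn_set_integral[of a "a + s" Q "exp (l * M)" "\<lambda>x. exp \<bar>x\<bar>"] s0 sM' sub
      by (simp add: abs_if)
  qed
  then show ?thesis by (simp add: emeasure_exp_measure[OF Q(1)] M_def s_def)
qed

lemma divide_mono_ennreal:
  fixes a b c d :: ennreal
  assumes "a \<le> c" "d \<le> b"
  shows "a / b \<le> c / d"
proof -
  have "inverse b \<le> inverse d"
    using assms(2) including ennreal.lifting by transfer (rule ereal_inverse_antimono)
  with assms(1) show ?thesis
    unfolding divide_ennreal_def by (intro mult_mono) auto
qed

lemma average_le:
  assumes "Q \<in> sets \<mu>" "emeasure \<mu> Q \<noteq> \<infinity>" "\<And>x. x \<in> Q \<Longrightarrow> f x \<le> c"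
  shows "average \<mu> Q f \<le> ennreal c"
proof -
  have "(\<integral>\<^sup>+x\<in>Q. ennreal (f x) \<partial>\<mu>) \<le> (\<integral>\<^sup>+x. ennreal c * indicator Q x \<partial>\<mu>)"
    using assms(3) by (intro nn_integral_mono) (auto simp: indicator_def intro!: ennreal_leI)
  also have "\<dots> = ennreal c * emeasure \<mu> Q"
    by (rule nn_integral_cmult_indicator[OF assms(1)])
  finally have "average \<mu> Q f \<le> ennreal c * emeasure \<mu> Q / emeasure \<mu> Q"
    unfolding average_def by (rule divide_right_mono_ennreal)
  \<comment> \<open>For a null set the quotient is 0 / 0, which is 0 in
    \<open>ennreal\<close>.\<close>
  also have "\<dots> \<le> ennreal c"
    using assms(2) by (cases "emeasure \<mu> Q = 0") (simp_all add: mult_divide_eq_ennreal)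
  finally show ?thesis .
qed

lemma average_exp_dual:
  assumes "Q \<in> sets lebesgue"
  shows "average exp_measure Q (\<lambda>x. exp (- \<bar>x\<bar>)) = emeasure lebesgue Q / emeasure exp_measure Q"
proof -
  have "(\<integral>\<^sup>+x\<in>Q. ennreal (exp (- \<bar>x\<bar>)) \<partial>exp_measure) = (\<integral>\<^sup>+x. indicator Q x \<partial>lebesgue)"
    using assms
    by (subst nn_integral_exp_measure)
       (auto simp: ennreal_mult'[symmetric] exp_minus intro!: nn_integral_cong)
  with assms show ?thesis by (simp add: average_def)
qed

text \<open>The general upper bound would give \<open>R * exp R\<close>. The factor \<open>R\<close>
  saved here is decisive: with it, the product of averages over \<open>{0..R}\<close> would be
  bounded below only by a multiple of \<open>1 / R\<close>, and no divergence would follow.\<close>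

lemma emeasure_exp_measure_Icc_0:
  assumes "0 \<le> R"
  shows "emeasure exp_measure {0..R} \<le> ennreal (exp R)"
proof -
  have "emeasure exp_measure {0..R} = (\<integral>\<^sup>+x\<in>{0..R}. ennreal (exp x) \<partial>lebesgue)"
    by (subst emeasure_exp_measure) (auto intro!: nn_integral_cong simp: indicator_def)
  also have "\<dots> = (\<integral>\<^sup>+x\<in>{0..R}. ennreal (exp x) \<partial>lborel)"
    by (rule nn_integral_completion)
  also have "\<dots> = ennreal (exp R - exp 0)"
    using assms by (intro nn_integral_FTC_Icc) (auto intro!: derivative_eq_intros)
  finally show ?thesis by (auto intro: ennreal_leI)
qed

section \<open>The weight and the bound in the dilated class\<close>

lemma weight_exp_abs: "weight (\<lambda>x. exp (c * \<bar>x\<bar>))"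
  unfolding weight_def
proof (intro conjI allI impI)
  fix K :: "real set" assume "compact K"
  then have "set_integrable lborel K (\<lambda>x. exp (c * \<bar>x\<bar>))"
    unfolding set_integrable_def
    by (intro borel_integrable_compact) (auto intro!: continuous_intros)
  then show "set_integrable lebesgue K (\<lambda>x. exp (c * \<bar>x\<bar>))"
    unfolding set_integrable_def
    using integrable_completion borel_measurable_integrable by blast
qed auto

lemma dual_exp_abs:
  fixes p x :: real
  assumes "1 < p"
  shows "exp ((p - 1) * \<bar>x\<bar>) powr (- 1 / (p - 1)) = exp (- \<bar>x\<bar>)"
  using assms by (simp add: powr_def)

lemma exp_abs_in_A_class:
  assumes "1 < p" "0 < l" "l < 1"
  shows "(\<lambda>x. exp ((p - 1) * \<bar>x\<bar>)) \<in> A_class (\<lambda>x. l * x) p exp_measure"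
proof -
  have "average exp_measure Q (\<lambda>x. exp ((p - 1) * \<bar>l * x\<bar>)) *
      ennreal_powr (average exp_measure Q (\<lambda>x. exp (- \<bar>x\<bar>))) (p - 1)
      \<le> ennreal ((2 / (1 - l)) powr (p - 1))" if Q: "Q \<in> bounded_intervals" for Q
  proof -
    note Ql = bounded_intervals_sets_lebesgue[OF Q]
    \<comment> \<open>Upper estimates use the closed interval and lower estimates the open one, so
      no case distinction on the endpoints of \<open>Q\<close> arises.\<close>
    obtain a b where ab: "a < b" "{a<..<b} \<subseteq> Q" "Q \<subseteq> {a..b}"
      using bounded_intervals_sandwich[OF Q] .
    define M where "M = max \<bar>a\<bar> \<bar>b\<bar>"
    have fin: "emeasure exp_measure Q \<noteq> \<infinity>"
      using emeasure_exp_measure_le[OF Ql ab(3)] ab(1) by (auto simp: top_unique)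
    have "\<bar>x\<bar> \<le> M" if "x \<in> Q" for x
      using that ab(3) by (force simp: M_def)
    then have "l * \<bar>x\<bar> \<le> l * M" if "x \<in> Q" for x
      using that assms by (intro mult_left_mono) auto
    then have 1: "average exp_measure Q (\<lambda>x. exp ((p - 1) * \<bar>l * x\<bar>)) \<le> ennreal (exp ((p - 1) * (l * M)))"
      using assms fin Ql by (intro average_le) (auto simp: abs_mult)
    have "average exp_measure Q (\<lambda>x. exp (- \<bar>x\<bar>)) = emeasure lebesgue Q / emeasure exp_measure Q"
      by (rule average_exp_dual[OF Ql])
    \<comment> \<open>Numerator and denominator are both bounded by multiples of
      \<open>b - a\<close>, so the length of \<open>Q\<close> cancels.\<close>
    also have "\<dots> \<le> ennreal (b - a) / ennreal (exp (l * M) * ((1 - l) * (b - a) / 2))"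
    proof (rule divide_mono_ennreal)
      show "emeasure lebesgue Q \<le> ennreal (b - a)"
        using emeasure_mono[OF ab(3), of lebesgue] ab(1) by simp
    qed (use emeasure_exp_measure_ge[OF Ql ab(2,1) assms(2,3)] in \<open>simp add: M_def\<close>)
    also have "\<dots> = ennreal (2 / (1 - l) * exp (- (l * M)))"
    proof -
      have "h / (exp (l * M) * (k * h / 2)) = 2 / k * exp (- (l * M))" if "0 < h" "0 < k" for h k
        using that by (simp add: exp_minus field_simps)
      from this[of "b - a" "1 - l"] show ?thesis
        using ab(1) assms by (subst divide_ennreal) auto
    qed
    finally have "ennreal_powr (average exp_measure Q (\<lambda>x. exp (- \<bar>x\<bar>))) (p - 1)
        \<le> ennreal_powr (ennreal (2 / (1 - l) * exp (- (l * M)))) (p - 1)"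
      using assms(1) by (intro ennreal_powr_mono) auto
    also have "\<dots> = ennreal ((2 / (1 - l) * exp (- (l * M))) powr (p - 1))"
      using assms by (intro ennreal_powr_ennreal) auto
    \<comment> \<open>This exponent is opposite to the one in the bound for the average of the
      dilated weight, so \<open>M\<close> drops out of the product.\<close>
    also have "\<dots> = ennreal ((2 / (1 - l)) powr (p - 1) * exp (- ((p - 1) * (l * M))))"
      by (subst powr_mult) (simp add: exp_powr_real mult.commute)
    finally have "average exp_measure Q (\<lambda>x. exp ((p - 1) * \<bar>l * x\<bar>)) *
        ennreal_powr (average exp_measure Q (\<lambda>x. exp (- \<bar>x\<bar>))) (p - 1)
        \<le> ennreal (exp ((p - 1) * (l * M))) *
          ennreal ((2 / (1 - l)) powr (p - 1) * exp (- ((p - 1) * (l * M))))"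
      using 1 by (intro mult_mono) auto
    also have "\<dots> = ennreal ((2 / (1 - l)) powr (p - 1))"
      by (simp add: ennreal_mult'[symmetric] exp_minus)
    finally show ?thesis .
  qed
  then show ?thesis
    unfolding A_class_def mem_Collect_eq dual_exp_abs[OF assms(1)]
    by (auto intro!: le_less_trans[OF SUP_least] simp: ennreal_less_top)
qed

section \<open>Divergence without the dilation\<close>

lemma exp_abs_notin_Ap_class:
  assumes "1 < p"
  shows "(\<lambda>x. exp ((p - 1) * \<bar>x\<bar>)) \<notin> Ap_class p exp_measure"
proof
  define F where "F Q = average exp_measure Q (\<lambda>x. exp ((p - 1) * \<bar>x\<bar>)) *
      ennreal_powr (average exp_measure Q (\<lambda>x. exp (- \<bar>x\<bar>))) (p - 1)" for Q
  assume "(\<lambda>x. exp ((p - 1) * \<bar>x\<bar>)) \<in> Ap_class p exp_measure"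
  then have fin: "(SUP Q\<in>bounded_intervals. F Q) < \<infinity>"
    unfolding Ap_class_def A_class_def mem_Collect_eq dual_exp_abs[OF assms] F_def .
  have lower: "ennreal (exp (- p) * R powr (p - 1)) \<le> (SUP Q\<in>bounded_intervals. F Q)"
    if R: "1 \<le> R" for R
  proof -
    let ?Q = "{0..R}"
    have Q: "?Q \<in> bounded_intervals" "?Q \<in> sets lebesgue"
      using R by (auto simp: bounded_intervals_def is_interval_cc)
    have mu: "emeasure exp_measure ?Q \<le> ennreal (exp R)"
      using R by (intro emeasure_exp_measure_Icc_0) auto
    \<comment> \<open>Weight times density is \<open>exp (p * \<bar>x\<bar>)\<close>, bounded below
      on the last unit interval, which lies in \<open>{0..R}\<close> because
      \<open>1 \<le> R\<close>. Its length is written \<open>R - (R - 1)\<close> to match the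
      general estimate.\<close>
    have "ennreal (exp (p * (R - 1)) * (R - (R - 1)))
        \<le> (\<integral>\<^sup>+x\<in>?Q. ennreal (exp (p * \<bar>x\<bar>)) \<partial>lebesgue)"
      using R assms by (intro interval_le_nn_set_integral) auto
    also have "\<dots> = (\<integral>\<^sup>+x\<in>?Q. (ennreal (exp \<bar>x\<bar>) * ennreal (exp ((p - 1) * \<bar>x\<bar>))) \<partial>lebesgue)"
      by (simp add: ennreal_mult'[symmetric] exp_add[symmetric] algebra_simps)
    also have "\<dots> = (\<integral>\<^sup>+x\<in>?Q. ennreal (exp ((p - 1) * \<bar>x\<bar>)) \<partial>exp_measure)"
      by (rule nn_integral_exp_measure[symmetric]) auto
    finally have "ennreal (exp (p * (R - 1))) / ennreal (exp R)
        \<le> average exp_measure ?Q (\<lambda>x. exp ((p - 1) * \<bar>x\<bar>))"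
      unfolding average_def by (intro divide_mono_ennreal mu) simp
    then have 1: "ennreal (exp (p * (R - 1)) / exp R)
        \<le> average exp_measure ?Q (\<lambda>x. exp ((p - 1) * \<bar>x\<bar>))"
      by (simp add: divide_ennreal)
    have "ennreal R / ennreal (exp R) \<le> average exp_measure ?Q (\<lambda>x. exp (- \<bar>x\<bar>))"
      unfolding average_exp_dual[OF Q(2)] using R by (intro divide_mono_ennreal mu) simp
    then have "ennreal_powr (ennreal (R / exp R)) (p - 1)
        \<le> ennreal_powr (average exp_measure ?Q (\<lambda>x. exp (- \<bar>x\<bar>))) (p - 1)"
      using assms R by (intro ennreal_powr_mono) (auto simp: divide_ennreal)
    then have 2: "ennreal ((R / exp R) powr (p - 1))
        \<le> ennreal_powr (average exp_measure ?Q (\<lambda>x. exp (- \<bar>x\<bar>))) (p - 1)"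
      using R by (simp add: ennreal_powr_ennreal)
    \<comment> \<open>All exponentials in \<open>R\<close> cancel; only the power
      \<open>R powr (p - 1)\<close> from the dual average remains, and the loss from the unit
      interval leaves \<open>exp (- p)\<close>.\<close>
    have "exp (- p) = exp (p * (R - 1)) / exp R * exp (- (R * (p - 1)))"
    proof -
      have "- p = p * (R - 1) - R + - (R * (p - 1))" by (simp add: algebra_simps)
      then show ?thesis unfolding exp_diff[symmetric] exp_add[symmetric] by (rule arg_cong)
    qed
    moreover have "(R / exp R) powr (p - 1) = R powr (p - 1) * exp (- (R * (p - 1)))"
      using R unfolding exp_minus divide_inverse[symmetric]
      by (subst powr_divide) (simp_all add: exp_powr_real)
    ultimately have "exp (- p) * R powr (p - 1)
        = exp (p * (R - 1)) / exp R * (R / exp R) powr (p - 1)"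
      by (simp only: mult.assoc mult.commute[of "R powr (p - 1)"])
    then have "ennreal (exp (- p) * R powr (p - 1))
        = ennreal (exp (p * (R - 1)) / exp R * (R / exp R) powr (p - 1))"
      by (rule arg_cong)
    also have "\<dots> = ennreal (exp (p * (R - 1)) / exp R) * ennreal ((R / exp R) powr (p - 1))"
      by (rule ennreal_mult') simp
    also have "\<dots> \<le> F ?Q"
      unfolding F_def using 1 2 by (intro mult_mono) auto
    also have "\<dots> \<le> (SUP Q\<in>bounded_intervals. F Q)"
      by (rule SUP_upper[OF Q(1)])
    finally show ?thesis .
  qed
  obtain B where B: "0 \<le> B" "(SUP Q\<in>bounded_intervals. F Q) = ennreal B"
    using fin unfolding infinity_ennreal_def less_top_ennreal by blast
  \<comment> \<open>The second entry solves \<open>exp (- p) * R powr (p - 1) = B + 1\<close>, so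
    the lower bound exceeds the supremum \<open>B\<close>; the maximum with 1 makes
    \<open>lower\<close> applicable.\<close>
  define R where "R = max 1 ((exp p * (B + 1)) powr (1 / (p - 1)))"
  have "exp p * (B + 1) = ((exp p * (B + 1)) powr (1 / (p - 1))) powr (p - 1)"
    unfolding powr_powr using B(1) assms by simp
  also have "\<dots> \<le> R powr (p - 1)"
    using assms by (intro powr_mono2) (auto simp: R_def)
  finally have "exp (- p) * (exp p * (B + 1)) \<le> exp (- p) * R powr (p - 1)"
    by (intro mult_left_mono) auto
  then have "B + 1 \<le> exp (- p) * R powr (p - 1)"
    by (simp only: mult.assoc[symmetric] exp_add[symmetric]) simp
  moreover have "exp (- p) * R powr (p - 1) \<le> B"
    using lower[of R] B by (simp add: R_def)
  ultimately show False by simp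
qed

theorem proposition1p7:
  fixes p l :: real
  assumes "1 < p" and "0 < l" and "l < 1"
  shows "\<exists>w. weight w \<and> w \<in> A_class (\<lambda>x. l * x) p exp_measure \<and> w \<notin> Ap_class p exp_measure"
  using weight_exp_abs exp_abs_in_A_class[OF assms] exp_abs_notin_Ap_class[OF assms(1)] by blast

end
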